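(* Let $G=(V,E)$ be a graph and let $s(G)=(G^1,G^2,X)$ be a splitting of $G$. Then $$Q(G,x)=\sum_{\beta\in\Pi(X)}\frac{1}{x^{|\beta|}}\sum_{\substack{\gamma^1,\gamma^2\in\Pi(X)\\ \gamma^1\vee\gamma^2=\beta}}T(G^1,\beta,\gamma^1;x)\,T(G^2,\beta,\gamma^2;x).$$
   Context: Graphs are finite, simple and undirected. For a finite set $Y$, $\Pi(Y)$ is the set of all set partitions of $Y$ (with $\Pi(\emptyset)=\{\emptyset\}$), $|\pi|$ is the number of blocks of $\pi$, and $\Pi(Y)$ is ordered by refinement ($\sigma\le\pi$ iff every block of $\sigma$ is contained in a block of $\pi$); this is a lattice and $\vee$ denotes its join. For $U\subseteq Y$ and $\pi\in\Pi(Y)$, $\pi\sqcap U\in\Pi(U)$ is the partition whose blocks are the nonempty sets $B\cap U$, $B\in\pi$; one says $\pi$ induces $\pi\sqcap U$ in $U$. A partition $\pi\in\Pi(V)$ is a connected set partition of $G=(V,E)$ if the induced subgraph $G[B]$ is connected for each block $B\in\pi$; $\Pi_c(G)$ is the set of these. The partition polynomial is $Q(G,x)=\sum_{\pi\in\Pi_c(G)}x^{|\pi|}$. A splitting $s(G)=(G^1,G^2,X)$ of $G$ consists of subgraphs $G^1=(V^1,E^1)$ and $G^2=(V^2,E^2)$ of $G$ with $E=E^1\cup E^2$, $E^1\cap E^2=\emptyset$, $V=V^1\cup V^2$ and $V^1\cap V^2=X$. For a graph $H$ with vertex set $V(H)\supseteq X$: $H_X$ is the graph obtained from $H$ by adding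 all missing edges between vertices of $X$ (so $X$ becomes a clique). For $\beta\in\Pi(X)$, $\Pi_c(H,\beta)$ is the set of connected set partitions $\pi$ of $H$ with $\pi\sqcap X=\beta$. For $\pi\in\Pi(V(H))$, $\{H[\pi]\}\in\Pi(V(H))$ is the partition whose blocks are the vertex sets of the connected components of the induced subgraphs $H[B]$, $B\in\pi$. For $\beta,\gamma\in\Pi(X)$, $$T(H,\beta,\gamma)=\{\pi\in\Pi_c(H_X,\beta):\{H[\pi]\}\sqcap X=\gamma\},\qquad T(H,\beta,\gamma;x)=\sum_{\pi\in T(H,\beta,\gamma)}x^{|\pi|}.$$ *)

theory Defs
  imports
    "HOL-Library.Disjoint_Sets"
    "HOL-Computational_Algebra.Polynomial_Factorial"
    "Graph_Theory.Digraph_Component"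
begin

text \<open>
  A finite simple undirected graph is a \<^locale>\<open>pair_graph\<close>: a finite loop-free digraph whose arc
  set is a symmetric relation, so that the edge \<open>{u, v}\<close> is the pair of arcs \<open>(u, v)\<close>, \<open>(v, u)\<close>.
  The null graph is allowed.
\<close>

definition set_partitions :: "'a set \<Rightarrow> 'a set set set" where
  "set_partitions Y = {\<pi>. partition_on Y \<pi>}"

definition induced_partition :: "'a set set \<Rightarrow> 'a set \<Rightarrow> 'a set set"  (infixl "\<sqinter>\<^sub>p" 70) where
  "\<pi> \<sqinter>\<^sub>p U = (\<lambda>B. B \<inter> U) ` \<pi> - {{}}"

definition is_partition_join :: "'a set \<Rightarrow> 'a set set \<Rightarrow> 'a set set \<Rightarrow> 'a set set \<Rightarrow> bool" where
  "is_partition_join Y \<pi> \<sigma> \<tau> \<longleftrightarrow>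
     refines Y \<pi> \<tau> \<and> refines Y \<sigma> \<tau> \<and>
     (\<forall>\<rho>. refines Y \<pi> \<rho> \<and> refines Y \<sigma> \<rho> \<longrightarrow> refines Y \<tau> \<rho>)"

definition partition_join :: "'a set \<Rightarrow> 'a set set \<Rightarrow> 'a set set \<Rightarrow> 'a set set" where
  "partition_join Y \<pi> \<sigma> = (THE \<tau>. is_partition_join Y \<pi> \<sigma> \<tau>)"

lemma is_partition_join_unique:
  "is_partition_join Y \<pi> \<sigma> \<tau> \<Longrightarrow> is_partition_join Y \<pi> \<sigma> \<tau>' \<Longrightarrow> \<tau> = \<tau>'"
  unfolding is_partition_join_def by (meson refines_asym)

lemma is_partition_join_exists:
  assumes "\<pi> \<in> set_partitions Y" "\<sigma> \<in> set_partitions Y"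
  shows "\<exists>\<tau>. is_partition_join Y \<pi> \<sigma> \<tau>"
proof -
  let ?U = "{\<rho>. refines Y \<pi> \<rho> \<and> refines Y \<sigma> \<rho>}"
  let ?J = "common_refinement ?U"
  have part: "partition_on Y \<pi>" "partition_on Y \<sigma>"
    using assms by (auto simp: set_partitions_def)
  have "partition_on Y ({Y} - {{}})"
    by (auto simp: partition_on_def disjoint_def)
  moreover have "\<exists>C\<in>{Y} - {{}}. B \<subseteq> C" if "B \<in> \<pi> \<union> \<sigma>" for B
    using that part by (auto simp: partition_on_def)
  ultimately have "{Y} - {{}} \<in> ?U"
    using part by (simp add: refines_def)
  then have ne: "?U \<noteq> {}" by blast
  have PU: "\<And>\<rho>. \<rho> \<in> ?U \<Longrightarrow> partition_on Y \<rho>" by (auto simp: refines_def)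
  have "refines Y \<xi> ?J" if "partition_on Y \<xi>" "\<And>\<rho>. \<rho> \<in> ?U \<Longrightarrow> refines Y \<xi> \<rho>" for \<xi>
    by (rule common_refinement_coarsest[OF PU that ne])
  then have "refines Y \<pi> ?J" "refines Y \<sigma> ?J"
    using part by blast+
  moreover have "refines Y ?J \<rho>" if "refines Y \<pi> \<rho>" "refines Y \<sigma> \<rho>" for \<rho>
    by (rule refines_common_refinement[OF PU]) (use that in auto)
  ultimately have "is_partition_join Y \<pi> \<sigma> ?J"
    unfolding is_partition_join_def by blast
  then show ?thesis by blast
qed

lemma partition_join_is_join:
  assumes "\<pi> \<in> set_partitions Y" "\<sigma> \<in> set_partitions Y"
  shows "is_partition_join Y \<pi> \<sigma> (partition_join Y \<pi> \<sigma>)"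
  unfolding partition_join_def
  using is_partition_join_exists[OF assms] is_partition_join_unique theI[of "is_partition_join Y \<pi> \<sigma>"]
  by blast

text \<open>The qualified name avoids the topological notion of connectedness.\<close>
definition connected_partitions :: "'a pair_pre_digraph \<Rightarrow> 'a set set set" where
  "connected_partitions G =
     {\<pi> \<in> set_partitions (pverts G). \<forall>B\<in>\<pi>. Digraph_Component.connected (with_proj G \<restriction> B)}"

definition partition_poly :: "'a pair_pre_digraph \<Rightarrow> int poly" where
  "partition_poly G = (\<Sum>\<pi>\<in>connected_partitions G. monom 1 (card \<pi>))"

definition splitting ::
    "'a pair_pre_digraph \<Rightarrow> 'a pair_pre_digraph \<Rightarrow> 'a pair_pre_digraph \<Rightarrow> 'a set \<Rightarrow> bool" where
  "splitting G G1 G2 X \<longleftrightarrow>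
     pair_graph G1 \<and> pair_graph G2 \<and> subgraph G1 G \<and> subgraph G2 G \<and>
     parcs G = parcs G1 \<union> parcs G2 \<and> parcs G1 \<inter> parcs G2 = {} \<and>
     pverts G = pverts G1 \<union> pverts G2 \<and> pverts G1 \<inter> pverts G2 = X"

definition add_clique :: "'a pair_pre_digraph \<Rightarrow> 'a set \<Rightarrow> 'a pair_pre_digraph" where
  "add_clique H X = H\<lparr>parcs := parcs H \<union> {(u, v). u \<in> X \<and> v \<in> X \<and> u \<noteq> v}\<rparr>"

definition connected_partitions_inducing ::
    "'a pair_pre_digraph \<Rightarrow> 'a set \<Rightarrow> 'a set set \<Rightarrow> 'a set set set" where
  "connected_partitions_inducing H X \<beta> = {\<pi> \<in> connected_partitions H. \<pi> \<sqinter>\<^sub>p X = \<beta>}"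

text \<open>
  In a symmetric digraph the strongly connected components are the connected components of the
  undirected graph; \<^const>\<open>pre_digraph.sccs_verts\<close> is the set of their vertex sets.
\<close>
definition component_partition :: "'a pair_pre_digraph \<Rightarrow> 'a set set \<Rightarrow> 'a set set" where
  "component_partition H \<pi> = (\<Union>B\<in>\<pi>. pre_digraph.sccs_verts (with_proj H \<restriction> B))"

definition T_set ::
    "'a pair_pre_digraph \<Rightarrow> 'a set \<Rightarrow> 'a set set \<Rightarrow> 'a set set \<Rightarrow> 'a set set set" where
  "T_set H X \<beta> \<gamma> =
     {\<pi> \<in> connected_partitions_inducing (add_clique H X) X \<beta>. component_partition H \<pi> \<sqinter>\<^sub>p X = \<gamma>}"

definition T_poly ::
    "'a pair_pre_digraph \<Rightarrow> 'a set \<Rightarrow> 'a set set \<Rightarrow> 'a set set \<Rightarrow> int poly" where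
  "T_poly H X \<beta> \<gamma> = (\<Sum>\<pi>\<in>T_set H X \<beta> \<gamma>. monom 1 (card \<pi>))"

end

theory Submission
  imports Defs
begin

text \<open>
  Read partitions as equivalence relations. A partition with relation \<open>E\<close> is connected iff
  \<open>E \<subseteq> (A \<inter> E)\<^sup>*\<close> for the arc relation \<open>A\<close>, restriction to \<open>U\<close> is intersection with \<open>U \<times> U\<close>, and
  joins are transitive closures of unions. Restricting a connected partition \<open>\<pi>\<close> of \<open>G\<close> to both
  sides gives connected partitions of \<open>G\<^sup>1\<^sub>X\<close> and \<open>G\<^sup>2\<^sub>X\<close>, because every excursion of a path into the
  other side starts and ends in the same block of \<open>\<pi> \<sqinter> X\<close>. Cutting paths at \<open>X\<close> shows that the
  connectivity inside the two sides joins to \<open>\<pi> \<sqinter> X\<close>. Conversely, two partitions agreeing on \<open>X\<close> are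
  glued by the transitive closure of the union of their relations, and the join condition makes the
  clique edges used inside the blocks superfluous. A block meeting both sides meets \<open>X\<close>, so
  inclusion-exclusion gives \<open>|\<pi>| = |\<pi>\<^sub>1| + |\<pi>\<^sub>2| - |\<beta>|\<close>.
\<close>

section \<open>Partitions as equivalence relations\<close>

definition block_rel :: "'a set set \<Rightarrow> 'a rel" where
  "block_rel \<pi> = {(u, v). \<exists>B\<in>\<pi>. u \<in> B \<and> v \<in> B}"

lemma equiv_block_rel: "partition_on Y \<pi> \<Longrightarrow> equiv Y (block_rel \<pi>)"
  unfolding block_rel_def by (rule equiv_partition_on)

lemma quotient_block_rel: "partition_on Y \<pi> \<Longrightarrow> Y // block_rel \<pi> = \<pi>"
  unfolding block_rel_def by (rule partition_on_eq_quotient)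

lemma block_rel_quotient:
  assumes "equiv Y r"
  shows "block_rel (Y // r) = r"
proof (rule set_eqI, clarify)
  fix u v
  have "(u, v) \<in> block_rel (Y // r) \<longleftrightarrow> (\<exists>x\<in>Y. (x, u) \<in> r \<and> (x, v) \<in> r)"
    by (auto simp: block_rel_def quotient_def)
  also have "\<dots> \<longleftrightarrow> (u, v) \<in> r"
    using assms by (meson equivE refl_onD symD transD equiv_class_eq_iff)
  finally show "(u, v) \<in> block_rel (Y // r) \<longleftrightarrow> (u, v) \<in> r" .
qed

lemma block_rel_inject:
  assumes "partition_on Y \<pi>" "partition_on Y \<sigma>"
  shows "block_rel \<pi> = block_rel \<sigma> \<longleftrightarrow> \<pi> = \<sigma>"
  using assms by (metis quotient_block_rel)

lemma block_rel_induced: "block_rel (\<pi> \<sqinter>\<^sub>p U) = block_rel \<pi> \<inter> U \<times> U"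
proof (rule set_eqI, clarify)
  fix u v
  \<comment> \<open>An empty block relates no elements, so discarding it leaves the relation
    unchanged.\<close>
  have "(\<exists>C\<in>\<P> - {{}}. u \<in> C \<and> v \<in> C) \<longleftrightarrow> (\<exists>C\<in>\<P>. u \<in> C \<and> v \<in> C)" for \<P> :: "'a set set"
    by auto
  then show "(u, v) \<in> block_rel (\<pi> \<sqinter>\<^sub>p U) \<longleftrightarrow> (u, v) \<in> block_rel \<pi> \<inter> U \<times> U"
    by (auto simp: block_rel_def induced_partition_def)
qed

lemma partition_on_induced:
  assumes "partition_on Y \<pi>" "U \<subseteq> Y"
  shows "partition_on U (\<pi> \<sqinter>\<^sub>p U)"
  using partition_on_restrict[OF assms(1), of U] assms(2)
  by (simp add: induced_partition_def Int_absorb2 Int_commute)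

lemma induced_induced:
  assumes "U \<subseteq> W"
  shows "\<pi> \<sqinter>\<^sub>p W \<sqinter>\<^sub>p U = \<pi> \<sqinter>\<^sub>p U"
proof -
  have "B \<inter> W \<inter> U = B \<inter> U" for B
    using assms by blast
  then have "(\<lambda>B. B \<inter> U) ` (\<lambda>B. B \<inter> W) ` \<pi> = (\<lambda>B. B \<inter> U) ` \<pi>"
    by (simp add: image_image)
  moreover have "(\<lambda>B. B \<inter> U) ` (\<P> - {{}}) - {{}} = (\<lambda>B. B \<inter> U) ` \<P> - {{}}" for \<P> :: "'a set set"
    by auto
  ultimately show ?thesis
    unfolding induced_partition_def by simp
qed

text \<open>From relations back to blocks: a block of \<pi> is nonempty, so one of its points
  selects a block of \<sigma>, and disjointness of \<sigma> forces all other points into that same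
  block.\<close>

lemma refines_iff_block_rel:
  assumes "partition_on Y \<pi>" "partition_on Y \<sigma>"
  shows "refines Y \<pi> \<sigma> \<longleftrightarrow> block_rel \<pi> \<subseteq> block_rel \<sigma>"
proof
  assume "refines Y \<pi> \<sigma>"
  then show "block_rel \<pi> \<subseteq> block_rel \<sigma>"
    unfolding refines_def block_rel_def by blast
next
  assume sub: "block_rel \<pi> \<subseteq> block_rel \<sigma>"
  have "\<exists>C\<in>\<sigma>. B \<subseteq> C" if "B \<in> \<pi>" for B
  proof -
    obtain u where "u \<in> B"
      using \<open>B \<in> \<pi>\<close> assms(1) by (metis partition_onD3 all_not_in_conv)
    then have "(u, u) \<in> block_rel \<sigma>"
      using sub \<open>B \<in> \<pi>\<close> by (auto simp: block_rel_def)
    then obtain C where C: "C \<in> \<sigma>" "u \<in> C"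
      by (auto simp: block_rel_def)
    have "v \<in> C" if "v \<in> B" for v
    proof -
      have "(u, v) \<in> block_rel \<sigma>"
        using sub \<open>B \<in> \<pi>\<close> \<open>u \<in> B\<close> \<open>v \<in> B\<close> by (auto simp: block_rel_def)
      then show ?thesis
        using C partition_onD2[OF assms(2)] by (auto simp: block_rel_def disjoint_def)
    qed
    then show ?thesis
      using C by blast
  qed
  then show "refines Y \<pi> \<sigma>"
    using assms by (simp add: refines_def)
qed

text \<open>The join is the quotient by the transitive closure of the union. The criterion splits
  into upper-bound conditions and a reachability condition, which are proved and used separately
  later.\<close>

lemma partition_join_eq_iff:
  assumes "partition_on Y \<pi>" "partition_on Y \<sigma>" "partition_on Y \<tau>"
  shows "partition_join Y \<pi> \<sigma> = \<tau> \<longleftrightarrow>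
    block_rel \<pi> \<subseteq> block_rel \<tau> \<and> block_rel \<sigma> \<subseteq> block_rel \<tau> \<and>
    block_rel \<tau> \<subseteq> (block_rel \<pi> \<union> block_rel \<sigma>)\<^sup>*"
proof -
  let ?r = "block_rel \<pi> \<union> block_rel \<sigma>"
  have eq: "equiv Y (block_rel \<pi>)" "equiv Y (block_rel \<sigma>)" "equiv Y (block_rel \<tau>)"
    using assms by (simp_all add: equiv_block_rel)
  have "?r \<subseteq> Y \<times> Y"
    using eq by (auto elim!: equivE)
  \<comment> \<open>The reflexive closure would also relate points outside \<open>Y\<close> to
    themselves; the irreflexive one stays inside \<open>Y\<close> and is still reflexive there,
    since each of the two relations is.\<close>
  have "equiv Y (?r\<^sup>+)"
  proof (rule equivI)
    show "?r\<^sup>+ \<subseteq> Y \<times> Y"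
      using \<open>?r \<subseteq> Y \<times> Y\<close> by (rule trancl_subset_Sigma)
    show "refl_on Y (?r\<^sup>+)"
      using eq by (auto elim!: equivE simp: refl_on_def)
    show "sym (?r\<^sup>+)"
      using eq by (auto elim!: equivE intro!: sym_trancl sym_Un)
  qed simp
  define \<rho> where "\<rho> = Y // ?r\<^sup>+"
  have \<rho>: "partition_on Y \<rho>" "block_rel \<rho> = ?r\<^sup>+"
    unfolding \<rho>_def using \<open>equiv Y (?r\<^sup>+)\<close>
    by (simp_all add: partition_on_quotient block_rel_quotient)
  have "is_partition_join Y \<pi> \<sigma> \<rho>"
    unfolding is_partition_join_def
  proof (intro conjI allI impI)
    show "refines Y \<pi> \<rho>" "refines Y \<sigma> \<rho>"
      using assms \<rho> by (auto simp: refines_iff_block_rel)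
    fix \<xi> assume *: "refines Y \<pi> \<xi> \<and> refines Y \<sigma> \<xi>"
    then have "partition_on Y \<xi>"
      by (simp add: refines_def)
    then have "?r \<subseteq> block_rel \<xi>" "trans (block_rel \<xi>)"
      using * assms equiv_block_rel[of Y \<xi>] by (auto simp: refines_iff_block_rel elim: equivE)
    then have "?r\<^sup>+ \<subseteq> block_rel \<xi>"
      by (metis trancl_id trancl_mono subrelI)
    then show "refines Y \<rho> \<xi>"
      using \<rho> \<open>partition_on Y \<xi>\<close> by (simp add: refines_iff_block_rel)
  qed
  then have "partition_join Y \<pi> \<sigma> = \<rho>"
    using assms is_partition_join_unique partition_join_is_join
    by (metis mem_Collect_eq set_partitions_def)
  then have "partition_join Y \<pi> \<sigma> = \<tau> \<longleftrightarrow> ?r\<^sup>+ = block_rel \<tau>"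
    using \<rho> assms(3) block_rel_inject by metis
  also have "\<dots> \<longleftrightarrow> ?r \<subseteq> block_rel \<tau> \<and> block_rel \<tau> \<subseteq> ?r\<^sup>*"
  proof
    assume "?r\<^sup>+ = block_rel \<tau>"
    then show "?r \<subseteq> block_rel \<tau> \<and> block_rel \<tau> \<subseteq> ?r\<^sup>*"
      by (metis r_into_trancl' subrelI trancl_into_rtrancl)
  next
    assume *: "?r \<subseteq> block_rel \<tau> \<and> block_rel \<tau> \<subseteq> ?r\<^sup>*"
    have "?r\<^sup>+ \<subseteq> block_rel \<tau>"
      using * eq(3) by (metis equivE trancl_id trancl_mono subrelI)
    \<comment> \<open>The two closures differ only by empty paths, which reflexivity on
      \<open>Y\<close> covers.\<close>
    moreover have "block_rel \<tau> \<subseteq> ?r\<^sup>+"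
    proof clarify
      fix u v assume "(u, v) \<in> block_rel \<tau>"
      then have "(u, v) \<in> ?r\<^sup>*" "u \<in> Y"
        using * eq(3) by (auto elim: equivE)
      then show "(u, v) \<in> ?r\<^sup>+"
        using \<open>equiv Y (?r\<^sup>+)\<close> by (metis equivE refl_onD rtranclD)
    qed
    ultimately show "?r\<^sup>+ = block_rel \<tau>"
      by blast
  qed
  finally show ?thesis
    by auto
qed

text \<open>Distinct blocks that meet \<open>U\<close> have distinct traces on \<open>U\<close>,
  because they are disjoint.\<close>

lemma card_induced:
  assumes "partition_on Y \<pi>"
  shows "card (\<pi> \<sqinter>\<^sub>p U) = card {B \<in> \<pi>. B \<inter> U \<noteq> {}}"
proof -
  have "inj_on (\<lambda>B. B \<inter> U) {B \<in> \<pi>. B \<inter> U \<noteq> {}}"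
    using partition_onD2[OF assms] by (fastforce simp: inj_on_def disjoint_def)
  moreover have "\<pi> \<sqinter>\<^sub>p U = (\<lambda>B. B \<inter> U) ` {B \<in> \<pi>. B \<inter> U \<noteq> {}}"
    by (auto simp: induced_partition_def)
  ultimately show ?thesis
    by (simp add: card_image)
qed

section \<open>Connected partitions and component partitions\<close>

text \<open>A path that starts in \<open>B\<close> and uses only pairs lying within blocks never
  leaves \<open>B\<close>. Thus reachability inside single blocks can be replaced by one closure for
  the whole partition.\<close>

lemma rtrancl_block_iff:
  assumes "partition_on Y \<pi>" "B \<in> \<pi>" "u \<in> B"
  shows "(u, v) \<in> rtrancl_on B (r \<inter> B \<times> B) \<longleftrightarrow> (u, v) \<in> (r \<inter> block_rel \<pi>)\<^sup>*"
proof
  assume "(u, v) \<in> rtrancl_on B (r \<inter> B \<times> B)"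
  then have "(u, v) \<in> (r \<inter> B \<times> B)\<^sup>*"
    by (rule rtrancl_on_rtranclI)
  moreover have "r \<inter> B \<times> B \<subseteq> r \<inter> block_rel \<pi>"
    using \<open>B \<in> \<pi>\<close> by (auto simp: block_rel_def)
  ultimately show "(u, v) \<in> (r \<inter> block_rel \<pi>)\<^sup>*"
    using rtrancl_mono by blast
next
  assume "(u, v) \<in> (r \<inter> block_rel \<pi>)\<^sup>*"
  then show "(u, v) \<in> rtrancl_on B (r \<inter> B \<times> B)"
  proof induction
    case base
    then show ?case using \<open>u \<in> B\<close> by simp
  next
    case (step v w)
    have "v \<in> B"
      using step.IH by (rule in_rtrancl_on_in_F)
    then have "w \<in> B"
      using step.hyps(2) \<open>B \<in> \<pi>\<close> partition_onD2[OF assms(1)]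
      by (auto simp: block_rel_def disjoint_def)
    with \<open>v \<in> B\<close> step show ?case
      by (auto intro: rtrancl_on_into_rtrancl_on)
  qed
qed

lemma arcs_ends_induce: "arcs_ends (with_proj H \<restriction> B) = parcs H \<inter> B \<times> B"
  by (auto simp: arcs_ends_def arc_to_ends_def)

lemma symcl_sym: "sym r \<Longrightarrow> symcl r = r"
  by (auto simp: symcl_def dest: symD)

lemma connected_induce_iff:
  assumes "sym (parcs H)" "partition_on Y \<pi>" "B \<in> \<pi>"
  shows "Digraph_Component.connected (with_proj H \<restriction> B) \<longleftrightarrow>
    B \<times> B \<subseteq> (parcs H \<inter> block_rel \<pi>)\<^sup>*"
proof -
  have "sym (parcs H \<inter> B \<times> B)"
    using assms(1) by (auto simp: sym_def)
  \<comment> \<open>Connectedness of a digraph includes having a vertex.\<close>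
  moreover have "B \<noteq> {}"
    using assms by (metis partition_onD3)
  ultimately show ?thesis
    using rtrancl_block_iff[OF assms(2,3), of _ _ "parcs H"]
    by (auto simp: connected_conv arcs_ends_induce symcl_sym)
qed

lemma connected_partitions_iff:
  assumes "sym (parcs H)"
  shows "\<pi> \<in> connected_partitions H \<longleftrightarrow>
    partition_on (pverts H) \<pi> \<and> block_rel \<pi> \<subseteq> (parcs H \<inter> block_rel \<pi>)\<^sup>*"
proof -
  have "(\<forall>B\<in>\<pi>. B \<times> B \<subseteq> S) \<longleftrightarrow> block_rel \<pi> \<subseteq> S" for S :: "'a rel"
    by (fastforce simp: block_rel_def)
  then show ?thesis
    using connected_induce_iff[OF assms, of "pverts H" \<pi>]
    by (simp add: connected_partitions_def set_partitions_def cong: conj_cong)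
qed

lemma equiv_connectivity:
  assumes "sym r" "partition_on Y \<pi>"
  shows "equiv Y ((r \<inter> block_rel \<pi>)\<^sup>* \<inter> Y \<times> Y)"
proof (rule equivI)
  have "sym ((r \<inter> block_rel \<pi>)\<^sup>*)"
    using assms equiv_block_rel[OF assms(2)] by (auto intro!: sym_rtrancl sym_Int elim: equivE)
  then show "sym ((r \<inter> block_rel \<pi>)\<^sup>* \<inter> Y \<times> Y)"
    by (auto simp: sym_def)
  show "trans ((r \<inter> block_rel \<pi>)\<^sup>* \<inter> Y \<times> Y)"
    by (auto simp: trans_def)
qed (auto simp: refl_on_def)

text \<open>Within a block, reachability coincides with the connectivity relation \<open>C\<close>,
  and classes of \<open>C\<close> never leave a block. Hence the components of all blocks together
  are exactly the classes of \<open>C\<close>.\<close>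

lemma component_partition_eq_quotient:
  assumes "sym (parcs H)" "partition_on Y \<pi>"
  shows "component_partition H \<pi> = Y // ((parcs H \<inter> block_rel \<pi>)\<^sup>* \<inter> Y \<times> Y)"
proof -
  define C where "C = (parcs H \<inter> block_rel \<pi>)\<^sup>* \<inter> Y \<times> Y"
  have C: "equiv Y C"
    unfolding C_def by (rule equiv_connectivity[OF assms])
  have sub: "B \<subseteq> Y" if "B \<in> \<pi>" for B
    using that assms(2) by (auto simp: partition_on_def)
  have reach: "reachable (with_proj H \<restriction> B) u v \<longleftrightarrow> u \<in> B \<and> v \<in> B \<and> (u, v) \<in> C"
    if "B \<in> \<pi>" for B u v
  proof -
    have "reachable (with_proj H \<restriction> B) u v \<longleftrightarrow> (u, v) \<in> rtrancl_on B (parcs H \<inter> B \<times> B)"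
      by (simp add: reachable_def arcs_ends_induce)
    then show ?thesis
      using rtrancl_block_iff[OF assms(2) that, of u v "parcs H"] sub[OF that]
        in_rtrancl_on_in_F[of u v B "parcs H \<inter> B \<times> B"]
      by (auto simp: C_def)
  qed
  have stay: "v \<in> B" if "B \<in> \<pi>" "u \<in> B" "(u, v) \<in> C" for B u v
    using rtrancl_block_iff[OF assms(2) that(1,2), of v "parcs H"] that(3)
      in_rtrancl_on_in_F(2)[of u v B "parcs H \<inter> B \<times> B"]
    by (auto simp: C_def)
  have symC: "(v, u) \<in> C" if "(u, v) \<in> C" for u v
    using C that by (meson equivE symD)
  have transC: "(u, w) \<in> C" if "(u, v) \<in> C" "(v, w) \<in> C" for u v w
    using C that by (meson equivE transD)
  have reflC: "(u, u) \<in> C" if "u \<in> Y" for u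
    using C that by (meson equivE refl_onD)
  have "S \<in> component_partition H \<pi> \<longleftrightarrow> S \<in> Y // C" for S
  proof
    assume "S \<in> component_partition H \<pi>"
    then obtain B where "B \<in> \<pi>" and S: "S \<in> pre_digraph.sccs_verts (with_proj H \<restriction> B)"
      by (auto simp: component_partition_def)
    note S = S[unfolded pre_digraph.sccs_verts_def mem_Collect_eq reach[OF \<open>B \<in> \<pi>\<close>]]
    then obtain u where "u \<in> S"
      by blast
    then have "u \<in> B"
      using S by blast
    \<comment> \<open>Mutual reachability gives one inclusion, maximality of the component the
      other.\<close>
    have "S = C `` {u}"
      using S \<open>u \<in> S\<close> \<open>u \<in> B\<close> stay[OF \<open>B \<in> \<pi>\<close>] symC by blast
    then show "S \<in> Y // C"
      using \<open>u \<in> B\<close> sub[OF \<open>B \<in> \<pi>\<close>] by (auto intro: quotientI)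
  next
    assume "S \<in> Y // C"
    then obtain u where "u \<in> Y" and S: "S = C `` {u}"
      by (auto elim: quotientE)
    then obtain B where "B \<in> \<pi>" "u \<in> B"
      using assms(2) by (auto simp: partition_on_def)
    have "S \<subseteq> B"
      using S stay \<open>B \<in> \<pi>\<close> \<open>u \<in> B\<close> by blast
    then have "S \<in> pre_digraph.sccs_verts (with_proj H \<restriction> B)"
      unfolding pre_digraph.sccs_verts_def mem_Collect_eq reach[OF \<open>B \<in> \<pi>\<close>]
      using S reflC[OF \<open>u \<in> Y\<close>] symC transC by blast
    then show "S \<in> component_partition H \<pi>"
      using \<open>B \<in> \<pi>\<close> by (auto simp: component_partition_def)
  qed
  then show ?thesis
    unfolding C_def by blast
qed

lemma
  assumes "sym (parcs H)" "partition_on Y \<pi>"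
  shows partition_on_component_partition: "partition_on Y (component_partition H \<pi>)"
    and block_rel_component_partition:
      "block_rel (component_partition H \<pi>) = (parcs H \<inter> block_rel \<pi>)\<^sup>* \<inter> Y \<times> Y"
  using equiv_connectivity[OF assms] component_partition_eq_quotient[OF assms]
  by (simp_all add: partition_on_quotient block_rel_quotient)

section \<open>Adding a clique, and basic facts about graphs and their partitions\<close>

lemma pverts_add_clique [simp]: "pverts (add_clique H X) = pverts H"
  by (simp add: add_clique_def)

lemma sym_parcs_add_clique: "sym (parcs H) \<Longrightarrow> sym (parcs (add_clique H X))"
  by (auto simp: add_clique_def sym_def)

text \<open>The clique is loop-free, but loops do not affect a reflexive closure, so the full square
  \<open>X \<times> X\<close> may stand for it.\<close>

lemma connected_partitions_add_clique_iff:
  assumes "sym (parcs H)"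
  shows "\<pi> \<in> connected_partitions (add_clique H X) \<longleftrightarrow>
    partition_on (pverts H) \<pi> \<and> block_rel \<pi> \<subseteq> ((parcs H \<union> X \<times> X) \<inter> block_rel \<pi>)\<^sup>*"
proof -
  have "(parcs (add_clique H X) \<inter> E) - Id = ((parcs H \<union> X \<times> X) \<inter> E) - Id" for E
    by (auto simp: add_clique_def)
  then have "(parcs (add_clique H X) \<inter> E)\<^sup>* = ((parcs H \<union> X \<times> X) \<inter> E)\<^sup>*" for E
    by (metis rtrancl_r_diff_Id)
  then show ?thesis
    using connected_partitions_iff[OF sym_parcs_add_clique[OF assms]] by simp
qed

lemma sym_parcs: "pair_graph H \<Longrightarrow> sym (parcs H)"
  by (auto intro!: symI dest: pair_sym_digraph.arcs_symmetric pair_pseudo_graph.axioms pair_graph.axioms)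

lemma parcs_subset: "pair_graph H \<Longrightarrow> parcs H \<subseteq> pverts H \<times> pverts H"
  by (auto dest!: pair_graph.axioms(1) pair_digraph.axioms(1) pair_fin_digraph.axioms(1)
      dest: pair_wf_digraph.wellformed')

lemma finite_set_partitions: "finite Y \<Longrightarrow> finite (set_partitions Y)"
  unfolding set_partitions_def by (rule finitely_many_partition_on)

lemma finite_connected_partitions: "finite (pverts H) \<Longrightarrow> finite (connected_partitions H)"
  using finite_set_partitions[of "pverts H"] by (simp add: connected_partitions_def)

lemma induced_component_partition_in_set_partitions:
  assumes "sym (parcs H)" "X \<subseteq> pverts H"
    and "\<pi> \<in> connected_partitions_inducing (add_clique H X) X \<beta>"
  shows "component_partition H \<pi> \<sqinter>\<^sub>p X \<in> set_partitions X"
proof -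
  have "partition_on (pverts H) \<pi>"
    using assms(3) by (auto simp: connected_partitions_inducing_def connected_partitions_def set_partitions_def)
  then show ?thesis
    using partition_on_induced[OF partition_on_component_partition[OF assms(1)] assms(2)]
    by (simp add: set_partitions_def)
qed

section \<open>Splitting a connected equivalence relation along a separator\<close>

text \<open>Induction along the path. While the path is in \<open>V2\<close>, the invariant
  remembers a separator vertex \<open>x\<close> that is already reached inside \<open>V1\<close> and
  is equivalent to the current vertex. On re-entering \<open>V1\<close>, the path is again at a
  separator vertex, and a clique pair from \<open>x\<close> replaces the excursion.\<close>

lemma path_crossing:
  assumes "R1 \<subseteq> V1 \<times> V1" "R2 \<subseteq> V2 \<times> V2" "equiv (V1 \<union> V2) E" "u \<in> V1"
    and "(u, w) \<in> ((R1 \<union> R2) \<inter> E)\<^sup>*"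
  defines "S \<equiv> (R1 \<union> (V1 \<inter> V2) \<times> (V1 \<inter> V2)) \<inter> (E \<inter> V1 \<times> V1)"
  shows "(w \<in> V1 \<longrightarrow> (u, w) \<in> S\<^sup>*) \<and>
    (w \<in> V2 \<longrightarrow> (\<exists>x\<in>V1 \<inter> V2. (u, x) \<in> S\<^sup>* \<and> (x, w) \<in> E))"
  using assms(5)
proof induction
  case base
  have "(u, u) \<in> E"
    using assms(3,4) by (meson UnI1 equivE refl_onD)
  then show ?case
    using assms(4) by blast
next
  case (step v w)
  have tr: "(x, z) \<in> E" if "(x, y) \<in> E" "(y, z) \<in> E" for x y z
    using assms(3) that by (meson equivE transD)
  have rf: "(x, x) \<in> E" if "x \<in> V1" for x
    using assms(3) that by (meson UnI1 equivE refl_onD)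
  consider "(v, w) \<in> R1" "(v, w) \<in> E" | "(v, w) \<in> R2" "(v, w) \<in> E"
    using step.hyps by blast
  then show ?case
  proof cases
    case 1
    then have "v \<in> V1" "w \<in> V1" "(v, w) \<in> S"
      using assms(1) by (auto simp: S_def)
    then have "(u, w) \<in> S\<^sup>*"
      using step.IH by (meson rtrancl.rtrancl_into_rtrancl)
    then show ?thesis
      \<comment> \<open>If \<open>w\<close> also lies in \<open>V2\<close>, then \<open>w\<close>
        itself is the required separator vertex.\<close>
      using \<open>w \<in> V1\<close> rf by blast
  next
    case 2
    then have "v \<in> V2" "w \<in> V2"
      using assms(2) by auto
    then obtain x where x: "x \<in> V1 \<inter> V2" "(u, x) \<in> S\<^sup>*" "(x, w) \<in> E"
      using step.IH 2 tr by blast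
    moreover have "(u, w) \<in> S\<^sup>*" if "w \<in> V1"
    proof -
      have "(x, w) \<in> S"
        using x that \<open>w \<in> V2\<close> by (auto simp: S_def)
      then show ?thesis
        using x by (meson rtrancl.rtrancl_into_rtrancl)
    qed
    ultimately show ?thesis
      by blast
  qed
qed

text \<open>Cutting the path at the separator: \<open>z\<close> is a cut vertex reached through
  pieces that each stay on one side, and the unfinished piece from \<open>z\<close> to the current
  vertex uses one side only.\<close>

lemma path_between_separator:
  assumes "R1 \<subseteq> V1 \<times> V1" "R2 \<subseteq> V2 \<times> V2" "u \<in> V1 \<inter> V2"
    and "(u, w) \<in> ((R1 \<union> R2) \<inter> E)\<^sup>*"
  defines "S1 \<equiv> (R1 \<inter> (E \<inter> V1 \<times> V1))\<^sup>*" and "S2 \<equiv> (R2 \<inter> (E \<inter> V2 \<times> V2))\<^sup>*"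
  defines "J \<equiv> (S1 \<inter> (V1 \<inter> V2) \<times> (V1 \<inter> V2) \<union> S2 \<inter> (V1 \<inter> V2) \<times> (V1 \<inter> V2))\<^sup>*"
  shows "\<exists>z\<in>V1 \<inter> V2. (u, z) \<in> J \<and> (w \<in> V1 \<and> (z, w) \<in> S1 \<or> w \<in> V2 \<and> (z, w) \<in> S2)"
  using assms(4)
proof induction
  case base
  then show ?case
    using assms(3) by (auto simp: J_def S1_def)
next
  case (step v w)
  obtain z where z: "z \<in> V1 \<inter> V2" "(u, z) \<in> J" "v \<in> V1 \<and> (z, v) \<in> S1 \<or> v \<in> V2 \<and> (z, v) \<in> S2"
    using step.IH by blast
  \<comment> \<open>When the current vertex lies in the separator, the unfinished piece is complete
    and this vertex can serve as the next cut vertex.\<close>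
  have vJ: "(u, v) \<in> J" if "v \<in> V1 \<inter> V2"
  proof -
    have "(z, v) \<in> S1 \<inter> (V1 \<inter> V2) \<times> (V1 \<inter> V2) \<union> S2 \<inter> (V1 \<inter> V2) \<times> (V1 \<inter> V2)"
      using z that by auto
    then show ?thesis
      using z(2) unfolding J_def by (rule rtrancl_into_rtrancl[rotated])
  qed
  consider "(v, w) \<in> R1" "(v, w) \<in> E" | "(v, w) \<in> R2" "(v, w) \<in> E"
    using step.hyps by blast
  then show ?case
  proof cases
    case 1
    then have v: "v \<in> V1" "w \<in> V1" and vw: "(v, w) \<in> R1 \<inter> (E \<inter> V1 \<times> V1)"
      using assms(1) by auto
    show ?thesis
    proof (cases "(z, v) \<in> S1")
      case True
      then have "(z, w) \<in> S1"
        using vw unfolding S1_def by (rule rtrancl_into_rtrancl)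
      then show ?thesis
        using z v by blast
    next
      case False
      \<comment> \<open>The piece from \<open>z\<close> ran through the second side while the next
        arc lies on the first, so the path changes sides at \<open>v\<close>.\<close>
      then have "v \<in> V1 \<inter> V2"
        using z v by blast
      moreover have "(v, w) \<in> S1"
        using vw unfolding S1_def by blast
      ultimately show ?thesis
        using v vJ by blast
    qed
  next
    case 2
    then have v: "v \<in> V2" "w \<in> V2" and vw: "(v, w) \<in> R2 \<inter> (E \<inter> V2 \<times> V2)"
      using assms(2) by auto
    show ?thesis
    proof (cases "(z, v) \<in> S2")
      case True
      then have "(z, w) \<in> S2"
        using vw unfolding S2_def by (rule rtrancl_into_rtrancl)
      then show ?thesis
        using z v by blast
    next
      case False
      then have "v \<in> V1 \<inter> V2"
        using z v by blast
      moreover have "(v, w) \<in> S2"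
        using vw unfolding S2_def by blast
      ultimately show ?thesis
        using v vJ by blast
    qed
  qed
qed

text \<open>Any alternating chain collapses to one \<open>E1\<close> step to a separator vertex
  followed by one \<open>E2\<close> step: by agreement on the separator, an \<open>E2\<close> step
  between separator vertices is also an \<open>E1\<close> step and is absorbed by
  transitivity.\<close>

lemma glued_rtrancl:
  assumes "equiv V1 E1" "equiv V2 E2"
    and "E1 \<inter> (V1 \<inter> V2) \<times> (V1 \<inter> V2) = E2 \<inter> (V1 \<inter> V2) \<times> (V1 \<inter> V2)"
    and "u \<in> V1" "(u, w) \<in> (E1 \<union> E2)\<^sup>*"
  shows "(w \<in> V1 \<longrightarrow> (u, w) \<in> E1) \<and> (w \<in> V2 \<longrightarrow> (\<exists>x\<in>V1 \<inter> V2. (u, x) \<in> E1 \<and> (x, w) \<in> E2))"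
  using assms(5)
proof induction
  case base
  then show ?case
    using assms by (meson IntI equivE refl_onD)
next
  case (step v w)
  have tr1: "(x, z) \<in> E1" if "(x, y) \<in> E1" "(y, z) \<in> E1" for x y z
    using assms(1) that by (meson equivE transD)
  have tr2: "(x, z) \<in> E2" if "(x, y) \<in> E2" "(y, z) \<in> E2" for x y z
    using assms(2) that by (meson equivE transD)
  have rf: "(x, x) \<in> E2" if "x \<in> V2" for x
    using assms(2) that by (meson equivE refl_onD)
  have sub: "E1 \<subseteq> V1 \<times> V1" "E2 \<subseteq> V2 \<times> V2"
    using assms(1,2) by (auto elim: equivE)
  consider "(v, w) \<in> E1" | "(v, w) \<in> E2"
    using step.hyps by blast
  then show ?case
  proof cases
    case 1
    then have "v \<in> V1" "w \<in> V1"
      using sub by auto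
    then have "(u, w) \<in> E1"
      using step.IH 1 tr1 by blast
    then show ?thesis
      using \<open>w \<in> V1\<close> rf by blast
  next
    case 2
    then have "v \<in> V2" "w \<in> V2"
      using sub by auto
    then obtain x where x: "x \<in> V1 \<inter> V2" "(u, x) \<in> E1" "(x, w) \<in> E2"
      using step.IH 2 tr2 by blast
    moreover have "(u, w) \<in> E1" if "w \<in> V1"
      using x that \<open>w \<in> V2\<close> assms(3) tr1 by blast
    ultimately show ?thesis
      by blast
  qed
qed

section \<open>Restricting a connected partition to the two sides of a splitting\<close>

locale graph_splitting =
  fixes G G1 G2 :: "'a pair_pre_digraph" and X :: "'a set"
  assumes pair_graph: "pair_graph G"
    and splitting: "splitting G G1 G2 X"
begin

abbreviation "V1 \<equiv> pverts G1"
abbreviation "V2 \<equiv> pverts G2"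

lemma pair_graph_part: "pair_graph G1" "pair_graph G2"
  using splitting by (auto simp: splitting_def)

lemma pverts_split: "pverts G = V1 \<union> V2"
  and parcs_split: "parcs G = parcs G1 \<union> parcs G2"
  and X_eq: "X = V1 \<inter> V2"
  using splitting by (auto simp: splitting_def)

lemmas sym_arcs = sym_parcs[OF pair_graph] sym_parcs[OF pair_graph_part(1)] sym_parcs[OF pair_graph_part(2)]
lemmas arcs_subset = parcs_subset[OF pair_graph_part(1)] parcs_subset[OF pair_graph_part(2)]

lemma finite_pverts: "finite V1" "finite V2" "finite (pverts G)"
proof -
  have "finite (pverts H)" if "pair_graph H" for H :: "'a pair_pre_digraph"
    using that by (auto dest!: pair_graph.axioms(1) pair_digraph.axioms(1)
        dest: pair_fin_digraph.pair_finite_verts)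
  then show "finite V1" "finite V2" "finite (pverts G)"
    using pair_graph pair_graph_part by auto
qed

text \<open>Transfers the facts proved for the first side to the second.\<close>

lemma swap: "graph_splitting G G2 G1 X"
  using pair_graph splitting unfolding graph_splitting_def splitting_def
  by (simp add: Un_commute Int_commute)

lemma connected_partitionD:
  assumes "\<pi> \<in> connected_partitions G"
  shows "partition_on (V1 \<union> V2) \<pi>" "equiv (V1 \<union> V2) (block_rel \<pi>)"
    and "block_rel \<pi> \<subseteq> ((parcs G1 \<union> parcs G2) \<inter> block_rel \<pi>)\<^sup>*"
  using assms equiv_block_rel[of "V1 \<union> V2" \<pi>]
  unfolding connected_partitions_iff[OF sym_arcs(1)] pverts_split parcs_split by simp_all

lemma induced_left_connected:
  assumes "\<pi> \<in> connected_partitions G"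
  shows "\<pi> \<sqinter>\<^sub>p V1 \<in> connected_partitions_inducing (add_clique G1 X) X (\<pi> \<sqinter>\<^sub>p X)"
proof -
  note \<pi> = connected_partitionD[OF assms]
  have "partition_on V1 (\<pi> \<sqinter>\<^sub>p V1)"
    using \<pi>(1) by (rule partition_on_induced) simp
  moreover have "block_rel (\<pi> \<sqinter>\<^sub>p V1) \<subseteq> ((parcs G1 \<union> X \<times> X) \<inter> block_rel (\<pi> \<sqinter>\<^sub>p V1))\<^sup>*"
    using \<pi>(3) path_crossing[OF arcs_subset \<pi>(2)] unfolding block_rel_induced X_eq by blast
  moreover have "\<pi> \<sqinter>\<^sub>p V1 \<sqinter>\<^sub>p X = \<pi> \<sqinter>\<^sub>p X"
    by (rule induced_induced) (simp add: X_eq)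
  ultimately show ?thesis
    using connected_partitions_add_clique_iff[OF sym_arcs(2)]
    by (simp add: connected_partitions_inducing_def)
qed

text \<open>The second conclusion of \<open>path_crossing\<close> supplies a separator vertex
  equivalent to any point of the block in \<open>V2\<close>.\<close>

lemma block_meets_separator:
  assumes "\<pi> \<in> connected_partitions G" "B \<in> \<pi>" "B \<inter> V1 \<noteq> {}" "B \<inter> V2 \<noteq> {}"
  shows "B \<inter> X \<noteq> {}"
proof -
  note \<pi> = connected_partitionD[OF assms(1)]
  obtain u w where uw: "u \<in> B" "u \<in> V1" "w \<in> B" "w \<in> V2"
    using assms by blast
  then have "(u, w) \<in> block_rel \<pi>"
    using \<open>B \<in> \<pi>\<close> by (auto simp: block_rel_def)
  then obtain x where x: "x \<in> X" "(x, w) \<in> block_rel \<pi>"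
    using \<pi>(3) path_crossing[OF arcs_subset \<pi>(2) \<open>u \<in> V1\<close>] \<open>w \<in> V2\<close> unfolding X_eq by blast
  then have "x \<in> B"
    using uw \<open>B \<in> \<pi>\<close> partition_onD2[OF \<pi>(1)] by (auto simp: block_rel_def disjoint_def)
  then show ?thesis
    using x by blast
qed

text \<open>Inclusion-exclusion on blocks, in additive form so that no subtraction of naturals
  occurs.\<close>

lemma card_split:
  assumes "\<pi> \<in> connected_partitions G"
  shows "card (\<pi> \<sqinter>\<^sub>p V1) + card (\<pi> \<sqinter>\<^sub>p V2) = card \<pi> + card (\<pi> \<sqinter>\<^sub>p X)"
proof -
  note \<pi> = connected_partitionD(1)[OF assms]
  let ?M = "\<lambda>U. {B \<in> \<pi>. B \<inter> U \<noteq> {}}"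
  have "finite \<pi>"
    using finite_elements[OF _ \<pi>] finite_pverts by simp
  then have "card (?M V1) + card (?M V2) = card (?M V1 \<union> ?M V2) + card (?M V1 \<inter> ?M V2)"
    by (intro card_Un_Int) auto
  moreover have "B \<inter> V1 \<noteq> {} \<or> B \<inter> V2 \<noteq> {}" if "B \<in> \<pi>" for B
    using that \<pi> partition_onD3[OF \<pi>] by (cases "B = {}") (auto simp: partition_on_def)
  then have "?M V1 \<union> ?M V2 = \<pi>"
    by blast
  moreover have "?M V1 \<inter> ?M V2 = ?M X"
    using block_meets_separator[OF assms] by (auto simp: X_eq)
  ultimately show ?thesis
    using card_induced[OF \<pi>] by simp
qed

lemma join_components:
  assumes "\<pi> \<in> connected_partitions G"
  shows "partition_join X (component_partition G1 (\<pi> \<sqinter>\<^sub>p V1) \<sqinter>\<^sub>p X)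
    (component_partition G2 (\<pi> \<sqinter>\<^sub>p V2) \<sqinter>\<^sub>p X) = \<pi> \<sqinter>\<^sub>p X"
proof -
  note \<pi> = connected_partitionD[OF assms]
  let ?E = "block_rel \<pi>"
  have part: "partition_on V1 (\<pi> \<sqinter>\<^sub>p V1)" "partition_on V2 (\<pi> \<sqinter>\<^sub>p V2)" "partition_on X (\<pi> \<sqinter>\<^sub>p X)"
    using partition_on_induced[OF \<pi>(1)] by (auto simp: X_eq)
  let ?c1 = "component_partition G1 (\<pi> \<sqinter>\<^sub>p V1)" and ?c2 = "component_partition G2 (\<pi> \<sqinter>\<^sub>p V2)"
  have c: "partition_on X (?c1 \<sqinter>\<^sub>p X)" "partition_on X (?c2 \<sqinter>\<^sub>p X)"
    using part partition_on_component_partition[OF sym_arcs(2) part(1)]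
      partition_on_component_partition[OF sym_arcs(3) part(2)]
    by (auto intro!: partition_on_induced simp: X_eq)
  have b1: "block_rel (?c1 \<sqinter>\<^sub>p X) = (parcs G1 \<inter> (?E \<inter> V1 \<times> V1))\<^sup>* \<inter> X \<times> X"
    unfolding block_rel_induced block_rel_component_partition[OF sym_arcs(2) part(1)]
    by (auto simp: X_eq)
  have b2: "block_rel (?c2 \<sqinter>\<^sub>p X) = (parcs G2 \<inter> (?E \<inter> V2 \<times> V2))\<^sup>* \<inter> X \<times> X"
    unfolding block_rel_induced block_rel_component_partition[OF sym_arcs(3) part(2)]
    by (auto simp: X_eq)
  \<comment> \<open>Leaving \<open>R\<close> and \<open>S\<close> arbitrary lets one induction give
    the upper-bound condition for both sides.\<close>
  have closed: "(u, v) \<in> ?E" if "(u, v) \<in> (R \<inter> (?E \<inter> S))\<^sup>*" "u \<in> X" for R S u v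
    using that
  proof induction
    case base
    then show ?case
      using \<pi>(2) by (auto simp: X_eq elim!: equivE dest: refl_onD)
  next
    case (step v w)
    then show ?case
      using \<pi>(2) by (blast elim: equivE dest: transD)
  qed
  show ?thesis
    unfolding partition_join_eq_iff[OF c part(3)]
  proof (intro conjI)
    show "block_rel (?c1 \<sqinter>\<^sub>p X) \<subseteq> block_rel (\<pi> \<sqinter>\<^sub>p X)" "block_rel (?c2 \<sqinter>\<^sub>p X) \<subseteq> block_rel (\<pi> \<sqinter>\<^sub>p X)"
      unfolding b1 b2 block_rel_induced[of \<pi>] using closed by blast+
    show "block_rel (\<pi> \<sqinter>\<^sub>p X) \<subseteq> (block_rel (?c1 \<sqinter>\<^sub>p X) \<union> block_rel (?c2 \<sqinter>\<^sub>p X))\<^sup>*" (is "_ \<subseteq> ?J")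
    proof clarify
      fix u w assume "(u, w) \<in> block_rel (\<pi> \<sqinter>\<^sub>p X)"
      then have uw: "u \<in> V1 \<inter> V2" "w \<in> V1 \<inter> V2" "(u, w) \<in> ((parcs G1 \<union> parcs G2) \<inter> ?E)\<^sup>*"
        using \<pi>(3) by (auto simp: block_rel_induced X_eq)
      obtain z where "z \<in> X" "(u, z) \<in> ?J"
        "(z, w) \<in> (parcs G1 \<inter> (?E \<inter> V1 \<times> V1))\<^sup>* \<or> (z, w) \<in> (parcs G2 \<inter> (?E \<inter> V2 \<times> V2))\<^sup>*"
        using path_between_separator[OF arcs_subset uw(1,3), folded X_eq, folded b1 b2] by blast
      \<comment> \<open>Both ends of the last piece lie in \<open>X\<close>, so it is itself a
        generator of the closure.\<close>
      then have "(z, w) \<in> block_rel (?c1 \<sqinter>\<^sub>p X) \<union> block_rel (?c2 \<sqinter>\<^sub>p X)"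
        using uw(2) unfolding b1 b2 X_eq[symmetric] by blast
      with \<open>(u, z) \<in> ?J\<close> show "(u, w) \<in> ?J"
        by (rule rtrancl_into_rtrancl)
    qed
  qed
qed

section \<open>Recovering a partition from its restrictions, and gluing two partitions\<close>

lemma block_rel_eq_glued:
  assumes "\<pi> \<in> connected_partitions G"
  shows "block_rel \<pi> =
    (block_rel (\<pi> \<sqinter>\<^sub>p V1) \<union> block_rel (\<pi> \<sqinter>\<^sub>p V2))\<^sup>* \<inter> (V1 \<union> V2) \<times> (V1 \<union> V2)"
proof -
  note \<pi> = connected_partitionD[OF assms]
  let ?F = "block_rel (\<pi> \<sqinter>\<^sub>p V1) \<union> block_rel (\<pi> \<sqinter>\<^sub>p V2)"
  \<comment> \<open>Every arc has both ends on one side, so connecting paths consist of pairs from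
    the two restrictions.\<close>
  have "(parcs G1 \<union> parcs G2) \<inter> block_rel \<pi> \<subseteq> ?F"
    using arcs_subset unfolding block_rel_induced by blast
  then have "block_rel \<pi> \<subseteq> ?F\<^sup>*"
    using \<pi>(3) rtrancl_mono by blast
  moreover have "block_rel \<pi> \<subseteq> (V1 \<union> V2) \<times> (V1 \<union> V2)"
    using \<pi>(2) by (auto elim: equivE)
  moreover have "(u, w) \<in> block_rel \<pi>" if "(u, w) \<in> ?F\<^sup>*" "u \<in> V1 \<union> V2" for u w
    using that
  proof induction
    case base
    then show ?case
      using \<pi>(2) by (meson equivE refl_onD)
  next
    case (step v w)
    then have "(v, w) \<in> block_rel \<pi>"
      unfolding block_rel_induced by blast
    then show ?case
      using step \<pi>(2) by (meson equivE transD)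
  qed
  ultimately show ?thesis
    by blast
qed

lemma glue_left:
  assumes "equiv V1 E1" "equiv V2 E2" "E1 \<inter> X \<times> X = E2 \<inter> X \<times> X"
  shows "(E1 \<union> E2)\<^sup>* \<inter> V1 \<times> V1 = E1"
  using glued_rtrancl[OF assms(1,2)] assms unfolding X_eq by (blast elim: equivE)

text \<open>This is surjectivity of the restriction map. The witness is the quotient by the closure
  of both relations; agreement on \<open>X\<close> makes its restrictions correct, and the join
  condition makes it connected.\<close>

lemma glue_connected:
  assumes \<pi>1: "\<pi>1 \<in> connected_partitions_inducing (add_clique G1 X) X \<beta>"
    and \<pi>2: "\<pi>2 \<in> connected_partitions_inducing (add_clique G2 X) X \<beta>"
    and join: "partition_join X (component_partition G1 \<pi>1 \<sqinter>\<^sub>p X) (component_partition G2 \<pi>2 \<sqinter>\<^sub>p X) = \<beta>"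
  shows "\<exists>\<pi>\<in>connected_partitions G. \<pi> \<sqinter>\<^sub>p V1 = \<pi>1 \<and> \<pi> \<sqinter>\<^sub>p V2 = \<pi>2"
proof -
  let ?E1 = "block_rel \<pi>1" and ?E2 = "block_rel \<pi>2" and ?V = "V1 \<union> V2"
  have part: "partition_on V1 \<pi>1" "partition_on V2 \<pi>2" and ind: "\<pi>1 \<sqinter>\<^sub>p X = \<beta>" "\<pi>2 \<sqinter>\<^sub>p X = \<beta>"
    and conn1: "?E1 \<subseteq> ((parcs G1 \<union> X \<times> X) \<inter> ?E1)\<^sup>*"
    and conn2: "?E2 \<subseteq> ((parcs G2 \<union> X \<times> X) \<inter> ?E2)\<^sup>*"
    using \<pi>1 \<pi>2 connected_partitions_add_clique_iff sym_arcs
    by (auto simp: connected_partitions_inducing_def)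
  have eq: "equiv V1 ?E1" "equiv V2 ?E2"
    using part by (simp_all add: equiv_block_rel)
  have \<beta>: "block_rel \<beta> = ?E1 \<inter> X \<times> X" "block_rel \<beta> = ?E2 \<inter> X \<times> X"
    using block_rel_induced ind by metis+
  define E where "E = (?E1 \<union> ?E2)\<^sup>* \<inter> ?V \<times> ?V"
  have sub: "?E1 \<subseteq> V1 \<times> V1" "?E2 \<subseteq> V2 \<times> V2"
    using eq by (auto elim: equivE)
  have "equiv ?V E"
  proof (rule equivI)
    have "sym ((?E1 \<union> ?E2)\<^sup>*)"
      using eq by (auto intro!: sym_rtrancl sym_Un elim: equivE)
    then show "sym E"
      by (auto simp: E_def sym_def)
    show "trans E"
      by (auto simp: E_def trans_def)
  qed (auto simp: E_def refl_on_def)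
  define \<pi> where "\<pi> = ?V // E"
  have \<pi>: "partition_on ?V \<pi>" "block_rel \<pi> = E"
    unfolding \<pi>_def using \<open>equiv ?V E\<close> by (simp_all add: partition_on_quotient block_rel_quotient)
  have "E \<inter> V1 \<times> V1 = ?E1"
    using glue_left[OF eq] \<beta> by (auto simp: E_def)
  then have ind1: "\<pi> \<sqinter>\<^sub>p V1 = \<pi>1"
    using block_rel_inject[OF partition_on_induced[OF \<pi>(1)] part(1)]
    by (simp add: block_rel_induced \<pi>(2))
  have "E \<inter> V2 \<times> V2 = ?E2"
    using graph_splitting.glue_left[OF swap eq(2,1)] \<beta> by (auto simp: E_def Un_commute)
  then have ind2: "\<pi> \<sqinter>\<^sub>p V2 = \<pi>2"
    using block_rel_inject[OF partition_on_induced[OF \<pi>(1)] part(2)]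
    by (simp add: block_rel_induced \<pi>(2))

  let ?R = "((parcs G1 \<union> parcs G2) \<inter> E)\<^sup>*"
  have E12: "?E1 \<subseteq> E" "?E2 \<subseteq> E"
    using sub by (auto simp: E_def)
  have c: "partition_on V1 (component_partition G1 \<pi>1)" "partition_on V2 (component_partition G2 \<pi>2)"
    using partition_on_component_partition part sym_arcs by auto
  have "partition_on X (component_partition G1 \<pi>1 \<sqinter>\<^sub>p X)" "partition_on X (component_partition G2 \<pi>2 \<sqinter>\<^sub>p X)"
    "partition_on X \<beta>"
    using partition_on_induced[OF c(1), of X] partition_on_induced[OF c(2), of X]
      partition_on_induced[OF part(1), of X] ind by (auto simp: X_eq)
  from join[unfolded partition_join_eq_iff[OF this]]
  \<comment> \<open>The join hypothesis enters here: separator vertices in a common block of \<beta>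
    are linked by paths running within blocks, using arcs of the two sides in turn.\<close>
  have "block_rel \<beta> \<subseteq> ((parcs G1 \<inter> ?E1)\<^sup>* \<union> (parcs G2 \<inter> ?E2)\<^sup>*)\<^sup>*"
    unfolding block_rel_induced block_rel_component_partition[OF sym_arcs(2) part(1)]
      block_rel_component_partition[OF sym_arcs(3) part(2)]
    by (meson Int_lower1 Un_mono order_trans rtrancl_mono)
  also have "\<dots> \<subseteq> ?R"
    using E12 by (intro rtrancl_subset_rtrancl Un_least rtrancl_mono) auto
  finally have \<beta>R: "block_rel \<beta> \<subseteq> ?R" .
  have "?E1 \<inter> X \<times> X \<subseteq> ?R" "?E2 \<inter> X \<times> X \<subseteq> ?R"
    using \<beta>R \<beta> by simp_all
  \<comment> \<open>A clique pair inside a block belongs to the relation of \<beta>, hence is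
    realised by a path in \<open>G\<close>.\<close>
  then have "(parcs G1 \<union> X \<times> X) \<inter> ?E1 \<subseteq> ?R" "(parcs G2 \<union> X \<times> X) \<inter> ?E2 \<subseteq> ?R"
    using E12 by blast+
  then have "?E1 \<union> ?E2 \<subseteq> ?R"
    using conn1 conn2 rtrancl_subset_rtrancl by blast
  then have "E \<subseteq> ?R"
    unfolding E_def by (meson Int_lower1 order_trans rtrancl_subset_rtrancl)
  then have "\<pi> \<in> connected_partitions G"
    using \<pi> by (simp add: connected_partitions_iff[OF sym_arcs(1)] pverts_split parcs_split)
  then show ?thesis
    using ind1 ind2 by blast
qed

section \<open>Bijection with compatible pairs, and the polynomial identity\<close>

definition compatible_pairs :: "'a set set \<Rightarrow> ('a set set \<times> 'a set set) set" where
  "compatible_pairs \<beta> = {(\<pi>1, \<pi>2).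
     \<pi>1 \<in> connected_partitions_inducing (add_clique G1 X) X \<beta> \<and>
     \<pi>2 \<in> connected_partitions_inducing (add_clique G2 X) X \<beta> \<and>
     partition_join X (component_partition G1 \<pi>1 \<sqinter>\<^sub>p X) (component_partition G2 \<pi>2 \<sqinter>\<^sub>p X) = \<beta>}"

text \<open>Injectivity is the recovery of a partition from its two restrictions; surjectivity is
  gluing.\<close>

lemma bij_betw_compatible_pairs:
  "bij_betw (\<lambda>\<pi>. (\<pi> \<sqinter>\<^sub>p V1, \<pi> \<sqinter>\<^sub>p V2)) (connected_partitions_inducing G X \<beta>) (compatible_pairs \<beta>)"
  (is "bij_betw ?f ?A ?B")
  unfolding bij_betw_def
proof
  show "inj_on ?f ?A"
  proof (rule inj_onI)
    fix \<pi> \<sigma> assume *: "\<pi> \<in> ?A" "\<sigma> \<in> ?A" "?f \<pi> = ?f \<sigma>"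
    then have "\<pi> \<in> connected_partitions G" "\<sigma> \<in> connected_partitions G"
      by (auto simp: connected_partitions_inducing_def)
    then show "\<pi> = \<sigma>"
      using *(3) block_rel_eq_glued block_rel_inject connected_partitionD(1)
      by (metis prod.inject)
  qed
  show "?f ` ?A = ?B"
  proof
    show "?f ` ?A \<subseteq> ?B"
      using induced_left_connected graph_splitting.induced_left_connected[OF swap] join_components
      by (auto simp: connected_partitions_inducing_def[of G] compatible_pairs_def)
    show "?B \<subseteq> ?f ` ?A"
    proof clarify
      fix \<pi>1 \<pi>2 assume *: "(\<pi>1, \<pi>2) \<in> ?B"
      then obtain \<pi> where \<pi>: "\<pi> \<in> connected_partitions G" "\<pi> \<sqinter>\<^sub>p V1 = \<pi>1" "\<pi> \<sqinter>\<^sub>p V2 = \<pi>2"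
        using glue_connected[of \<pi>1 \<beta> \<pi>2] by (auto simp: compatible_pairs_def)
      have "\<pi> \<sqinter>\<^sub>p X = \<pi>1 \<sqinter>\<^sub>p X"
        unfolding \<pi>(2)[symmetric] by (rule induced_induced[symmetric]) (simp add: X_eq)
      also have "\<dots> = \<beta>"
        using * by (auto simp: compatible_pairs_def connected_partitions_inducing_def)
      finally have "\<pi> \<in> ?A"
        using \<pi> by (simp add: connected_partitions_inducing_def)
      then show "(\<pi>1, \<pi>2) \<in> ?f ` ?A"
        using \<pi> by (auto intro!: image_eqI[of _ _ \<pi>])
    qed
  qed
qed

text \<open>The products expand to a sum over compatible pairs, sorted by the component partitions
  they induce in \<open>X\<close>; the bijection turns this into a sum over partitions of
  \<open>G\<close>. With the power of x on the right, the identity stays among polynomials.\<close>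

lemma sum_T_poly_eq:
  "(\<Sum>(\<gamma>1, \<gamma>2) \<in> {(\<gamma>1, \<gamma>2). \<gamma>1 \<in> set_partitions X \<and> \<gamma>2 \<in> set_partitions X \<and>
                        partition_join X \<gamma>1 \<gamma>2 = \<beta>}. T_poly G1 X \<beta> \<gamma>1 * T_poly G2 X \<beta> \<gamma>2) =
   monom 1 (card \<beta>) * (\<Sum>\<pi>\<in>connected_partitions_inducing G X \<beta>. monom 1 (card \<pi>))"
  (is "sum ?t ?J = _")
proof -
  let ?C = "\<lambda>H. connected_partitions_inducing (add_clique H X) X \<beta>"
  let ?g = "\<lambda>(\<pi>1, \<pi>2). (component_partition G1 \<pi>1 \<sqinter>\<^sub>p X, component_partition G2 \<pi>2 \<sqinter>\<^sub>p X)"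
  let ?h = "\<lambda>(\<pi>1, \<pi>2). monom 1 (card \<pi>1) * monom 1 (card \<pi>2) :: int poly"
  have fin: "finite (?C G1)" "finite (?C G2)"
    using finite_pverts by (auto simp: connected_partitions_inducing_def intro!: finite_subset[OF _ finite_connected_partitions])
  have "finite X" and X_subset: "X \<subseteq> V1" "X \<subseteq> V2"
    using finite_pverts by (auto simp: X_eq)
  have "finite ?J"
    by (rule finite_subset[of _ "set_partitions X \<times> set_partitions X"])
      (use finite_set_partitions[OF \<open>finite X\<close>] in auto)
  have "finite (compatible_pairs \<beta>)"
    by (rule finite_subset[of _ "?C G1 \<times> ?C G2"]) (use fin in \<open>auto simp: compatible_pairs_def\<close>)
  have "?g ` compatible_pairs \<beta> \<subseteq> ?J"
    using induced_component_partition_in_set_partitions[OF sym_arcs(2)]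
      induced_component_partition_in_set_partitions[OF sym_arcs(3)] X_subset
    by (auto simp: compatible_pairs_def)
  have "sum ?t ?J = (\<Sum>y\<in>?J. \<Sum>p\<in>{p \<in> compatible_pairs \<beta>. ?g p = y}. ?h p)"
  proof (rule sum.cong)
    fix y assume "y \<in> ?J"
    then obtain \<gamma>1 \<gamma>2 where y: "y = (\<gamma>1, \<gamma>2)" "partition_join X \<gamma>1 \<gamma>2 = \<beta>"
      by auto
    \<comment> \<open>Once both component partitions are fixed, the join condition holds for the
      whole fibre, which is therefore a product set and its sum factors.\<close>
    have "{p \<in> compatible_pairs \<beta>. ?g p = y} = T_set G1 X \<beta> \<gamma>1 \<times> T_set G2 X \<beta> \<gamma>2"
      using y by (auto simp: compatible_pairs_def T_set_def)
    then show "?t y = (\<Sum>p\<in>{p \<in> compatible_pairs \<beta>. ?g p = y}. ?h p)"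
      by (simp add: y(1) T_poly_def sum_product sum.cartesian_product)
  qed simp
  also have "\<dots> = sum ?h (compatible_pairs \<beta>)"
    by (rule sum.group) fact+
  also have "\<dots> = (\<Sum>\<pi>\<in>connected_partitions_inducing G X \<beta>. ?h (\<pi> \<sqinter>\<^sub>p V1, \<pi> \<sqinter>\<^sub>p V2))"
    by (rule sum.reindex_bij_betw[OF bij_betw_compatible_pairs, symmetric])
  \<comment> \<open>Exponents add up by \<open>card_split\<close>, with \<beta> as the partition
    induced in \<open>X\<close>.\<close>
  also have "\<dots> = (\<Sum>\<pi>\<in>connected_partitions_inducing G X \<beta>. monom 1 (card \<beta>) * monom 1 (card \<pi>))"
    by (rule sum.cong)
      (auto simp: mult_monom card_split connected_partitions_inducing_def add.commute)
  finally show ?thesis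
    by (simp add: sum_distrib_left)
qed

lemma partition_poly_eq_sum:
  "partition_poly G =
    (\<Sum>\<beta>\<in>set_partitions X. \<Sum>\<pi>\<in>connected_partitions_inducing G X \<beta>. monom 1 (card \<pi>))"
proof -
  have "finite (connected_partitions G)" "finite (set_partitions X)"
    using finite_pverts by (simp_all add: finite_connected_partitions finite_set_partitions X_eq)
  moreover have "(\<lambda>\<pi>. \<pi> \<sqinter>\<^sub>p X) ` connected_partitions G \<subseteq> set_partitions X"
    using partition_on_induced[OF connected_partitionD(1), of _ X]
    by (auto simp: set_partitions_def X_eq)
  ultimately show ?thesis
    unfolding partition_poly_def connected_partitions_inducing_def
    by (rule sum.group[symmetric])
qed

end

theorem theorem16:
  fixes G G1 G2 :: "'a pair_pre_digraph" and X :: "'a set"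
  assumes "pair_graph G"
    and "splitting G G1 G2 X"
  shows "(to_fract (partition_poly G) :: int poly fract) =
    (\<Sum>\<beta>\<in>set_partitions X.
       1 / to_fract (monom 1 (card \<beta>)) *
       (\<Sum>(\<gamma>1, \<gamma>2) \<in> {(\<gamma>1, \<gamma>2). \<gamma>1 \<in> set_partitions X \<and> \<gamma>2 \<in> set_partitions X \<and>
                              partition_join X \<gamma>1 \<gamma>2 = \<beta>}.
          to_fract (T_poly G1 X \<beta> \<gamma>1) * to_fract (T_poly G2 X \<beta> \<gamma>2)))"
proof -
  interpret graph_splitting G G1 G2 X
    using assms by (simp add: graph_splitting_def)
  have "1 / to_fract (monom 1 (card \<beta>)) *
      (\<Sum>(\<gamma>1, \<gamma>2) \<in> {(\<gamma>1, \<gamma>2). \<gamma>1 \<in> set_partitions X \<and> \<gamma>2 \<in> set_partitions X \<and>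
                             partition_join X \<gamma>1 \<gamma>2 = \<beta>}.
         to_fract (T_poly G1 X \<beta> \<gamma>1) * to_fract (T_poly G2 X \<beta> \<gamma>2)) =
      to_fract (\<Sum>\<pi>\<in>connected_partitions_inducing G X \<beta>. monom 1 (card \<pi>))" for \<beta>
  proof -
    \<comment> \<open>This allows the power of x to be cancelled in the fraction field.\<close>
    have "monom (1 :: int) (card \<beta>) \<noteq> 0"
      by simp
    then show ?thesis
      using arg_cong[OF sum_T_poly_eq[of \<beta>], of to_fract]
      by (simp add: to_fract_sum case_prod_unfold)
  qed
  then show ?thesis
    by (simp add: partition_poly_eq_sum to_fract_sum)
qed

end
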